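(* Let $\{x_i\}_{i=1}^m$ be a unit-norm frame for $\mathbb{R}^n$. If $\{c_ix_i\}_{i=1}^m$ is a Parseval frame for $\mathbb{R}^n$ for some nonzero real scalars $\{c_i\}_{i=1}^m$, then $$\max_i c_i^2\le 1=\frac{\sum_{i=1}^m c_i^2}{n}.$$ Moreover, for each $i\in\{1,\dots,m\}$, $|c_i|=1$ if and only if $x_i\perp x_j$ for all $1\le j\le m$ with $j\neq i$.
   Context: A finite family $\{x_i\}_{i=1}^m$ in $\mathbb{R}^n$ is a frame for $\mathbb{R}^n$ if there are constants $0<A\le B<\infty$ with $A\|x\|^2\le\sum_{i=1}^m|\langle x,x_i\rangle|^2\le B\|x\|^2$ for all $x\in\mathbb{R}^n$; it is unit-norm if all $\|x_i\|=1$, and Parseval if $\sum_{i=1}^m|\langle x,x_i\rangle|^2=\|x\|^2$ for all $x\in\mathbb{R}^n$. *)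

theory Defs
  imports "HOL-Analysis.Analysis"
begin

text \<open>A family of \<open>m\<close> vectors is a function on \<open>nat\<close> of which only the values at
  \<open>1, \<dots>, m\<close> matter. Repeated vectors are allowed.\<close>

definition frame :: "nat \<Rightarrow> (nat \<Rightarrow> real ^ 'n) \<Rightarrow> bool" where
  "frame m x \<longleftrightarrow>
     (\<exists>A B :: real. 0 < A \<and> A \<le> B \<and>
       (\<forall>v. A * (norm v)\<^sup>2 \<le> (\<Sum>i=1..m. \<bar>v \<bullet> x i\<bar>\<^sup>2) \<and>
            (\<Sum>i=1..m. \<bar>v \<bullet> x i\<bar>\<^sup>2) \<le> B * (norm v)\<^sup>2))"

definition unit_norm_frame :: "nat \<Rightarrow> (nat \<Rightarrow> real ^ 'n) \<Rightarrow> bool" where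
  "unit_norm_frame m x \<longleftrightarrow> frame m x \<and> (\<forall>i\<in>{1..m}. norm (x i) = 1)"

definition parseval_frame :: "nat \<Rightarrow> (nat \<Rightarrow> real ^ 'n) \<Rightarrow> bool" where
  "parseval_frame m x \<longleftrightarrow>
     frame m x \<and> (\<forall>v. (\<Sum>i=1..m. \<bar>v \<bullet> x i\<bar>\<^sup>2) = (norm v)\<^sup>2)"

end

theory Submission
  imports Defs
begin

text \<open>Testing the Parseval identity on \<open>x i\<close> gives
  \<open>1 = (c i)\<^sup>2 + (\<Sum>j\<noteq>i. (c j)\<^sup>2 * (x i \<bullet> x j)\<^sup>2)\<close>, whose remainder is nonnegative and vanishes
  exactly when \<open>x i\<close> is orthogonal to all the other vectors. Testing it on an orthonormal basis
  and exchanging the sums gives the value of \<open>\<Sum>i. (c i)\<^sup>2\<close>.\<close>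

text \<open>Both sides are the trace of the frame operator of \<open>y\<close>, which the hypothesis
  forces to be the identity.\<close>

lemma parseval_sum_norm_squares:
  fixes y :: "'i \<Rightarrow> 'a :: euclidean_space"
  assumes "\<And>v. (\<Sum>i\<in>I. (v \<bullet> y i)\<^sup>2) = (norm v)\<^sup>2"
  shows "(\<Sum>i\<in>I. (norm (y i))\<^sup>2) = real DIM('a)"
proof -
  have "(\<Sum>i\<in>I. (norm (y i))\<^sup>2) = (\<Sum>i\<in>I. \<Sum>b\<in>Basis. (b \<bullet> y i)\<^sup>2)"
    unfolding power2_norm_eq_inner euclidean_inner[of "y _" "y _"]
    by (simp add: power2_eq_square inner_commute)
  also have "\<dots> = (\<Sum>b\<in>(Basis :: 'a set). (norm b)\<^sup>2)"
    by (subst sum.swap) (simp only: assms)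
  finally show ?thesis
    by simp
qed

theorem proposition5p1:
  fixes m :: nat and x :: "nat \<Rightarrow> real ^ 'n" and c :: "nat \<Rightarrow> real"
  assumes "unit_norm_frame m x"
    and "\<forall>i\<in>{1..m}. c i \<noteq> 0"
    and "parseval_frame m (\<lambda>i. c i *\<^sub>R x i)"
  shows "Max ((\<lambda>i. (c i)\<^sup>2) ` {1..m}) \<le> 1
    \<and> 1 = (\<Sum>i=1..m. (c i)\<^sup>2) / real CARD('n)
    \<and> (\<forall>i\<in>{1..m}. \<bar>c i\<bar> = 1 \<longleftrightarrow> (\<forall>j\<in>{1..m}. j \<noteq> i \<longrightarrow> orthogonal (x i) (x j)))"
proof -
  have unit: "norm (x i) = 1" if "i \<in> {1..m}" for i
    using assms(1) that by (simp add: unit_norm_frame_def)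
  have parseval: "(\<Sum>i=1..m. (v \<bullet> (c i *\<^sub>R x i))\<^sup>2) = (norm v)\<^sup>2" for v
    using assms(3) by (simp add: parseval_frame_def)
  have sum_eq: "(\<Sum>i=1..m. (c i)\<^sup>2) = real CARD('n)"
    using parseval_sum_norm_squares[OF parseval] unit by (simp add: power_mult_distrib)
  \<comment> \<open>An empty sum would be 0, whereas the dimension is positive; hence the
    \<open>Max\<close> in the goal ranges over a nonempty set.\<close>
  then have "m \<noteq> 0"
    by (intro notI) simp
  define R where "R i = (\<Sum>j\<in>{1..m} - {i}. (c j)\<^sup>2 * (x i \<bullet> x j)\<^sup>2)" for i
  have R_nonneg: "0 \<le> R i" for i
    unfolding R_def by (intro sum_nonneg) simp
  have split: "(c i)\<^sup>2 + R i = 1" if i: "i \<in> {1..m}" for i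
  proof -
    have "(c i)\<^sup>2 + R i = (\<Sum>j=1..m. (c j)\<^sup>2 * (x i \<bullet> x j)\<^sup>2)"
      \<comment> \<open>The term \<open>j = i\<close> contributes exactly
        \<open>(c i)\<^sup>2\<close>, since \<open>x i \<bullet> x i = 1\<close>.\<close>
      unfolding R_def using i unit[OF i]
      by (subst sum.remove[of _ i]) (simp_all add: norm_eq_1)
    also have "\<dots> = 1"
      using parseval[of "x i"] unit[OF i] by (simp add: power_mult_distrib)
    finally show ?thesis .
  qed
  have "\<bar>c i\<bar> = 1 \<longleftrightarrow> (\<forall>j\<in>{1..m}. j \<noteq> i \<longrightarrow> orthogonal (x i) (x j))" if i: "i \<in> {1..m}" for i
  proof -
    have "\<bar>c i\<bar> = 1 \<longleftrightarrow> R i = 0"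
      using split[OF i] abs_square_eq_1[of "c i"] by linarith
    also have "\<dots> \<longleftrightarrow> (\<forall>j\<in>{1..m} - {i}. (c j)\<^sup>2 * (x i \<bullet> x j)\<^sup>2 = 0)"
      unfolding R_def by (intro sum_nonneg_eq_0_iff) auto
    \<comment> \<open>As each \<open>c j\<close> is nonzero, a vanishing product forces
      \<open>x i \<bullet> x j = 0\<close>.\<close>
    finally show ?thesis
      using assms(2) by (auto simp: orthogonal_def)
  qed
  moreover have "(c i)\<^sup>2 \<le> 1" if "i \<in> {1..m}" for i
    using split[OF that] R_nonneg[of i] by linarith
  ultimately show ?thesis
    using sum_eq \<open>m \<noteq> 0\<close> by (simp add: Max_le_iff)
qed

end
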